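(* Let $n\ge 0$ be an integer. The summands in the four sums $$\sum_{k=0}^{n}\binom{n}{k}\binom{2k}{k}2^{k}=\sum_{k=0}^{n}\binom{n}{k}\binom{2n-k}{n}3^{k}=\sum_{k=0}^{n}\binom{n}{k}^{2}4^{k}=\sum_{0\le k\le n/2}\binom{n}{2k}\binom{2k}{k}4^{k}5^{n-2k}$$ have the following combinatorial interpretations. (a) For $0\le k\le n$, $\binom{n}{k}\binom{2k}{k}2^{k}$ is the number of Hanna $n$-deals with exactly $k$ cards in red's hand. (b) For $0\le k\le n$, $\binom{n}{k}\binom{2n-k}{n}3^{k}$ is the number of Hanna $n$-paths for which $X+Y=k$, where $X$ is the number of matching pairs of slanted steps not both labeled $1$, and $Y$ is the number of flatsteps whose label exceeds $2$. (c) For $0\le k\le n$, $\binom{n}{k}^{2}4^{k}$ is the number of Hanna $n$-matrices with exactly $n-k$ $1$s in each row; equivalently, it is the number of Hanna $n$-deals with exactly $k$ distinct denominations appearing in red's hand. (d) For $0\le k\le n/2$, $\binom{n}{2k}\binom{2k}{k}4^{k}5^{n-2k}$ is the number of Hanna $n$-paths with exactly $k$ upsteps.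
   Context: A Delannoy path is a lattice path of upsteps $U=(1,1)$, downsteps $D=(1,-1)$ and flatsteps $F=(1,0)$ with an equal number of $U$s and $D$s (it may go below its starting level). The horizontal line joining its endpoints is ground level. Each upstep has a matching downstep: given an upstep above ground level (resp. below ground level), travel directly east (resp. west) from it until a downstep is encountered. That is, with ground level at height $0$, an upstep from height $h$ to $h+1$ is matched, if $h\ge 0$, with the first later downstep from height $h+1$ to $h$, and, if $h<0$, with the last earlier downstep from height $h+1$ to $h$. This partitions the slanted steps ($U$ and $D$) into matching pairs. A Hanna $n$-path is a Delannoy path with $n$ steps in total, each labeled: each slanted step gets one of the two labels $1,2$, and each flatstep gets one of the five labels $1,2,3,4,5$. A Hanna $n$-deal is formed as follows. Start with a deck of $3n$ cards, $n$ each colored red, green and blue, with one card of each color in each denomination $1,\dots,n$. Choose an arbitrary subset of the denominations and deal all cards of the chosen denominations to three players designated red, green and blue, in such a way that no player receives a card of her own color and, if there are $j$ denominations in the deal, red's hand contains exactly $j$ cards (the remaining $2j$ cards are split arbitrarily between the green and blue players, subject to no player receiving a card of her own color). A deal is determined by the set of cards in each hand. A Hanna $n$-matrix is a $2\times n$ matrix with entries in $\{1,2,3\}$ and the same number of $1$s in each row. *)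

theory Defs
  imports Main "Jordan_Normal_Form.Matrix"
begin

datatype step = Up | Down | Flat

fun rise :: "step \<Rightarrow> int" where
  "rise Up = 1"
| "rise Down = - 1"
| "rise Flat = 0"

definition delannoy_path :: "step list \<Rightarrow> bool" where
  "delannoy_path w \<longleftrightarrow> count_list w Up = count_list w Down"

text \<open>Steps are indexed from \<open>0\<close>; \<open>height w i\<close> is the height at which step \<open>i\<close> starts.\<close>

definition height :: "step list \<Rightarrow> nat \<Rightarrow> int" where
  "height w i = (\<Sum>s\<leftarrow>take i w. rise s)"

definition down_from :: "step list \<Rightarrow> int \<Rightarrow> nat \<Rightarrow> bool" where
  "down_from w h j \<longleftrightarrow> j < length w \<and> w ! j = Down \<and> height w j = h"

text \<open>\<open>matched w i j\<close>: the upstep at position \<open>i\<close> is matched with the downstep at position \<open>j\<close>.\<close>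

definition matched :: "step list \<Rightarrow> nat \<Rightarrow> nat \<Rightarrow> bool" where
  "matched w i j \<longleftrightarrow> i < length w \<and> w ! i = Up \<and> down_from w (height w i + 1) j \<and>
     (if height w i \<ge> 0
      then i < j \<and> (\<forall>m. i < m \<and> m < j \<longrightarrow> \<not> down_from w (height w i + 1) m)
      else j < i \<and> (\<forall>m. j < m \<and> m < i \<longrightarrow> \<not> down_from w (height w i + 1) m))"

fun step_labels :: "step \<Rightarrow> nat set" where
  "step_labels Up = {1, 2}"
| "step_labels Down = {1, 2}"
| "step_labels Flat = {1, 2, 3, 4, 5}"

definition hanna_paths :: "nat \<Rightarrow> (step \<times> nat) list set" where
  "hanna_paths n = {p. length p = n \<and> delannoy_path (map fst p) \<and>
     (\<forall>(s, l) \<in> set p. l \<in> step_labels s)}"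

definition num_upsteps :: "(step \<times> nat) list \<Rightarrow> nat" where
  "num_upsteps p = count_list (map fst p) Up"

definition pairs_not_both_1 :: "(step \<times> nat) list \<Rightarrow> nat" where
  "pairs_not_both_1 p =
     card {(i, j). matched (map fst p) i j \<and> \<not> (snd (p ! i) = 1 \<and> snd (p ! j) = 1)}"

definition flats_above_2 :: "(step \<times> nat) list \<Rightarrow> nat" where
  "flats_above_2 p = card {i. i < length p \<and> fst (p ! i) = Flat \<and> snd (p ! i) > 2}"

datatype color = Red | Green | Blue

text \<open>
  A card is a pair of a color and a denomination. Players are also identified by colors, and a
  deal maps each player to her hand; the set \<open>S\<close> of denominations dealt is determined by the hands.
\<close>

definition hanna_deals :: "nat \<Rightarrow> (color \<Rightarrow> (color \<times> nat) set) set" where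
  "hanna_deals n = {hand. \<exists>S \<subseteq> {1..n}.
     (\<Union>c. hand c) = UNIV \<times> S \<and>
     (\<forall>c c'. c \<noteq> c' \<longrightarrow> hand c \<inter> hand c' = {}) \<and>
     (\<forall>c d. (c, d) \<notin> hand c) \<and>
     card (hand Red) = card S}"

definition ones_in_row :: "nat mat \<Rightarrow> nat \<Rightarrow> nat" where
  "ones_in_row A i = card {j. j < dim_col A \<and> A $$ (i, j) = 1}"

definition hanna_matrices :: "nat \<Rightarrow> nat mat set" where
  "hanna_matrices n = {A \<in> carrier_mat 2 n.
     (\<forall>i < 2. \<forall>j < n. A $$ (i, j) \<in> {1, 2, 3}) \<and> ones_in_row A 0 = ones_in_row A 1}"

end

theory Submission
  imports Defs "HOL-Computational_Algebra.Polynomial" "HOL-Library.FuncSet"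
begin

text \<open>
  Three of the four sums are equal because a quadratic polynomial factors. The fourth sum is the
  coefficient of \<open>x\<^sup>n\<close> in \<open>(4 + 5 x + x\<^sup>2)\<^sup>n\<close>, and \<open>4 + 5 x + x\<^sup>2 = (1 + x) (4 + x)\<close> turns it into the third
  (\<open>sum_squares_eq_sum_trinomial\<close>). Writing \<open>4 + x = (1 + x) + 3\<close> and expanding turns it into the second;
  this works with a parameter, as \<open>(1 + z) + (2 + z) x + x\<^sup>2 = (1 + x) (1 + x + z)\<close>
  (\<open>sum_trinomial_eq_sum_shifted\<close> with \<open>z = 3 Y\<close>). The first and third sums agree because they count the same
  deals by two different statistics.
  
  For the deals, the count by distinct denominations rests on a change of description: besides the set
  \<open>T\<close> of denominations in red's hand, one records the set \<open>R\<close> of dealt denominations of which red does not hold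
  two cards. The condition on the size of red's hand becomes \<open>card T = card R\<close>, and deals,
  like matrices, become pairs of \<open>k\<close>-subsets with \<open>2 k\<close> further binary choices.
  
  For the paths, the matching is a bijection from upsteps to downsteps
  (\<open>bij_betw_partner\<close>). A labeling of a word with \<open>k\<close> upsteps is therefore an independent choice of two
  labels for each of \<open>k\<close> matching pairs and one label for each of \<open>n - 2 k\<close> flatsteps. Let \<open>Y\<close> mark
  the matching pairs not both labeled \<open>1\<close> and the flatsteps with label above \<open>2\<close>, so that its exponent
  is \<open>weight\<close>. The labelings of such a word then contribute \<open>(1 + 3 Y)\<^sup>k (2 + 3 Y)\<^bsup>n - 2 k\<^esup>\<close>
  (\<open>sum_labelings\<close>). Multiplying by the number of words gives the count by upsteps at \<open>Y = 1\<close>. Summing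
  over \<open>k\<close> gives the parametrised trinomial coefficient above, whose expansion in powers of \<open>Y\<close> is the
  count by weight.
\<close>

section \<open>Central trinomial coefficients\<close>

lemma coeff_binomial_middle:
  fixes a c :: "'a :: comm_semiring_1"
  shows "coeff (([:a:] + monom c 2) ^ i) i =
    (if even i then of_nat (i choose (i div 2)) * (a * c) ^ (i div 2) else 0)"
proof -
  have "coeff (([:a:] + monom c 2) ^ i) i =
      (\<Sum>j\<le>i. if 2 * (i - j) = i then of_nat (i choose j) * a ^ j * c ^ (i - j) else 0)"
    by (subst binomial_ring)
       (auto simp: coeff_sum monom_power of_nat_mult_conv_smult poly_const_pow mult_ac intro!: sum.cong)
  also have "\<dots> = (\<Sum>j\<le>i. if j = i div 2 then
      (if even i then of_nat (i choose (i div 2)) * (a * c) ^ (i div 2) else 0) else 0)"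
  proof (rule sum.cong)
    fix j assume "j \<in> {..i}"
    then have "2 * (i - j) = i \<longleftrightarrow> j = i div 2 \<and> even i"
      by auto presburger+
    moreover have "i - i div 2 = i div 2" if "even i"
      using that by presburger
    ultimately show "(if 2 * (i - j) = i then of_nat (i choose j) * a ^ j * c ^ (i - j) else 0) =
      (if j = i div 2 then
      (if even i then of_nat (i choose (i div 2)) * (a * c) ^ (i div 2) else 0) else 0)"
      by (auto simp: power_mult_distrib mult_ac)
  qed simp
  also have "\<dots> = (if even i then of_nat (i choose (i div 2)) * (a * c) ^ (i div 2) else 0)"
    by (simp add: sum.delta)
  finally show ?thesis .
qed

text \<open>
  Choosing \<open>c x\<^sup>2\<close> from \<open>k\<close> factors and \<open>a\<close> from \<open>k\<close> others is the only way to reach total degree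
  \<open>n\<close>. Every occurrence of the fourth sum below, with numerical or polynomial weights, is an
  instance of this coefficient.
\<close>

lemma coeff_trinomial_power:
  fixes a b c :: "'a :: comm_semiring_1"
  shows "coeff ([:a, b, c:] ^ n) n =
    (\<Sum>k | 2 * k \<le> n. of_nat ((n choose (2 * k)) * ((2 * k) choose k)) * (a * c) ^ k * b ^ (n - 2 * k))"
    (is "_ = sum ?f _")
proof -
  let ?g = "\<lambda>i. of_nat (n choose i) * b ^ (n - i) *
    (if even i then of_nat (i choose (i div 2)) * (a * c) ^ (i div 2) else 0)"
  have split: "[:a, b, c:] = ([:a:] + monom c 2) + monom b 1"
    by (simp add: monom_altdef power2_eq_square)
  have "coeff ([:a, b, c:] ^ n) n = (\<Sum>i\<le>n. of_nat (n choose i) *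
      (b ^ (n - i) * coeff (([:a:] + monom c 2) ^ i) i))"
    unfolding split
    by (subst binomial_ring)
       (auto simp: coeff_sum monom_power of_nat_mult_conv_smult coeff_monom_mult
          mult.commute[of "_ ^ _" "monom _ _"] mult.assoc intro!: sum.cong)
  also have "\<dots> = (\<Sum>i\<le>n. ?g i)"
    by (simp only: coeff_binomial_middle mult.assoc)
  also have "\<dots> = (\<Sum>i\<in>(\<lambda>k. 2 * k) ` {k. 2 * k \<le> n}. ?g i)"
    by (rule sum.mono_neutral_right) (auto elim!: evenE)
  also have "\<dots> = (\<Sum>k | 2 * k \<le> n. ?f k)"
    by (subst sum.reindex) (auto simp: inj_on_def mult_ac intro!: sum.cong)
  finally show ?thesis .
qed

text \<open>
  The left-hand side is the coefficient of \<open>x\<^sup>n\<close> in \<open>((1 + 3 Y) + (2 + 3 Y) x + x\<^sup>2)\<^sup>n\<close>. The quadratic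
  factors as \<open>(1 + x) (1 + x + 3 Y)\<close>; expanding the power of the second factor in powers of \<open>3 Y\<close>
  leaves the coefficients of \<open>(1 + x)\<^bsup>2 n - m\<^esup>\<close>. Keeping \<open>Y\<close> in an arbitrary semiring lets \<open>Y = 1\<close>
  give an identity between numbers, while an indeterminate \<open>Y\<close> gives the refined count of paths.
\<close>

lemma sum_trinomial_eq_sum_shifted:
  fixes Y :: "'a :: comm_semiring_1"
  shows "(\<Sum>k | 2 * k \<le> n. of_nat ((n choose (2 * k)) * ((2 * k) choose k)) *
      (1 + 3 * Y) ^ k * (2 + 3 * Y) ^ (n - 2 * k)) =
    (\<Sum>m\<le>n. of_nat ((n choose m) * ((2 * n - m) choose n) * 3 ^ m) * Y ^ m)"
proof -
  have "(\<Sum>k | 2 * k \<le> n. of_nat ((n choose (2 * k)) * ((2 * k) choose k)) *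
      (1 + 3 * Y) ^ k * (2 + 3 * Y) ^ (n - 2 * k)) = coeff ([:1 + 3 * Y, 2 + 3 * Y, 1:] ^ n) n"
    by (simp add: coeff_trinomial_power)
  also have "[:1 + 3 * Y, 2 + 3 * Y, 1:] = [:1, 1:] * ([:3 * Y:] + [:1, 1:])"
    by (simp add: algebra_simps flip: one_add_one)
  also have "coeff (\<dots> ^ n) n = (\<Sum>m\<le>n. of_nat (n choose m) *
      ((3 * Y) ^ m * coeff ([:1, 1:] ^ n * [:1, 1:] ^ (n - m)) n))"
    unfolding power_mult_distrib
    by (subst binomial_ring)
       (auto simp: coeff_sum of_nat_mult_conv_smult poly_const_pow sum_distrib_left mult_ac
          intro!: sum.cong)
  also have "\<dots> = (\<Sum>m\<le>n. of_nat ((n choose m) * ((2 * n - m) choose n) * 3 ^ m) * Y ^ m)"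
  proof (rule sum.cong)
    fix m assume "m \<in> {..n}"
    then have "n + (n - m) = 2 * n - m" "n \<le> 2 * n - m" by auto
    then show "of_nat (n choose m) * ((3 * Y) ^ m * coeff ([:1, 1:] ^ n * [:1, 1:] ^ (n - m)) n) =
        of_nat ((n choose m) * ((2 * n - m) choose n) * 3 ^ m) * Y ^ m"
      unfolding power_add[symmetric]
      by (simp add: coeff_linear_poly_power power_mult_distrib mult_ac)
  qed simp
  finally show ?thesis .
qed

text \<open>
  Both sides are the coefficient of \<open>x\<^sup>n\<close> in \<open>(4 + 5 x + x\<^sup>2)\<^sup>n = (1 + x)\<^sup>n (4 + x)\<^sup>n\<close>.
\<close>

lemma sum_squares_eq_sum_trinomial:
  "(\<Sum>k=0..n. (n choose k) ^ 2 * 4 ^ k) =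
    (\<Sum>k | 2 * k \<le> n. (n choose (2 * k)) * ((2 * k) choose k) * 4 ^ k * 5 ^ (n - 2 * k))"
proof -
  have "(\<Sum>k | 2 * k \<le> n. (n choose (2 * k)) * ((2 * k) choose k) * 4 ^ k * 5 ^ (n - 2 * k)) =
      coeff ([:4, 5, 1 :: nat:] ^ n) n"
    by (simp add: coeff_trinomial_power)
  also have "[:4, 5, 1 :: nat:] = [:1, 1:] * [:4, 1:]"
    by simp
  also have "coeff (\<dots> ^ n) n = (\<Sum>k\<le>n. (n choose k) * ((n choose (n - k)) * 4 ^ k))"
    unfolding power_mult_distrib by (auto simp: coeff_mult coeff_linear_poly_power intro!: sum.cong)
  also have "\<dots> = (\<Sum>k=0..n. (n choose k) ^ 2 * 4 ^ k)"
    by (auto simp: atMost_atLeast0 power2_eq_square binomial_symmetric[symmetric] intro!: sum.cong)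
  finally show ?thesis ..
qed

lemma sum_shifted_eq_sum_trinomial:
  "(\<Sum>k=0..n. (n choose k) * ((2 * n - k) choose n) * 3 ^ k) =
    (\<Sum>k | 2 * k \<le> n. (n choose (2 * k)) * ((2 * k) choose k) * 4 ^ k * 5 ^ (n - 2 * k))"
  using sum_trinomial_eq_sum_shifted[of n "1 :: nat"] by (simp add: atMost_atLeast0)

section \<open>Counting tools\<close>

lemma count_list_conv_card: "count_list xs x = card {i. i < length xs \<and> xs ! i = x}"
  unfolding count_list_eq_length_filter length_filter_conv_card
  by (rule arg_cong[where f = card]) auto

definition k_subsets :: "'a set \<Rightarrow> nat \<Rightarrow> 'a set set" where
  "k_subsets A k = {B. B \<subseteq> A \<and> card B = k}"

lemma finite_k_subsets: "finite A \<Longrightarrow> finite (k_subsets A k)"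
  unfolding k_subsets_def by simp

lemma card_k_subsets: "finite A \<Longrightarrow> card (k_subsets A k) = card A choose k"
  unfolding k_subsets_def by (rule n_subsets)

lemma card_k_subsets_pairs:
  assumes "finite A"
    and "\<And>P Q. P \<in> k_subsets A k \<Longrightarrow> Q \<in> k_subsets A k \<Longrightarrow>
      finite (F P Q) \<and> card (F P Q) = c"
  shows "card (SIGMA P:k_subsets A k. SIGMA Q:k_subsets A k. F P Q) = (card A choose k)\<^sup>2 * c"
  using assms by (simp add: finite_k_subsets card_k_subsets power2_eq_square)

lemma card_filter_bij_betw:
  assumes "bij_betw f A B"
  shows "card {b \<in> B. P b} = card {a \<in> A. P (f a)}"
proof -
  have "bij_betw f {a \<in> A. P (f a)} {b \<in> B. P b}"
    using assms by (auto simp: bij_betw_def inj_on_def)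
  then show ?thesis by (rule bij_betw_same_card[symmetric])
qed

lemma sum_card_fibres:
  fixes f :: "'a \<Rightarrow> nat"
  assumes "finite A" "\<And>x. x \<in> A \<Longrightarrow> f x \<le> n"
  shows "(\<Sum>k=0..n. card {x \<in> A. f x = k}) = card A"
  using sum.group[of A "{0..n}" f "\<lambda>_. 1 :: nat"] assms by (simp add: image_subset_iff)

lemma prod_if_power:
  fixes Y :: "'a :: comm_monoid_mult"
  assumes "finite A"
  shows "(\<Prod>x\<in>A. if P x then Y else 1) = Y ^ card {x \<in> A. P x}"
  using assms by (simp add: prod.inter_filter[symmetric])

section \<open>Matrices\<close>

text \<open>
  A matrix is determined by the columns \<open>T\<close>, \<open>R\<close> where its two rows differ from \<open>1\<close> and the subsets
  \<open>V\<close>, \<open>W\<close> of these where the entry is \<open>3\<close>. The row condition says that \<open>T\<close> and \<open>R\<close> have size \<open>k\<close>.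
\<close>

lemma card_hanna_matrices:
  assumes "k \<le> n"
  shows "card {A \<in> hanna_matrices n. \<forall>i < 2. ones_in_row A i = n - k} = (n choose k)\<^sup>2 * 4 ^ k"
proof -
  define X where "X = (SIGMA T:k_subsets {..<n} k. SIGMA R:k_subsets {..<n} k. Pow T \<times> Pow R)"
  define entry :: "nat set \<Rightarrow> nat set \<Rightarrow> nat \<Rightarrow> nat" where
    "entry T V j = (if j \<in> T then if j \<in> V then 3 else 2 else 1)" for T V j
  define enc :: "nat set \<times> nat set \<times> nat set \<times> nat set \<Rightarrow> nat mat" where
    "enc = (\<lambda>(T, R, V, W). mat 2 n (\<lambda>(i, j). if i = 0 then entry T V j else entry R W j))"
  define supp where "supp = (\<lambda>(A :: nat mat) i. {j. j < n \<and> A $$ (i, j) \<noteq> 1})"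
  define threes where "threes = (\<lambda>(A :: nat mat) i. {j. j < n \<and> A $$ (i, j) = 3})"
  have ones: "ones_in_row A i = n - card (supp A i)" if "A \<in> carrier_mat 2 n" for A i
  proof -
    have "{j. j < dim_col A \<and> A $$ (i, j) = 1} = {..<n} - supp A i"
      using that by (auto simp: supp_def)
    moreover have "supp A i \<subseteq> {..<n}" by (auto simp: supp_def)
    ultimately show ?thesis
      unfolding ones_in_row_def by (simp add: card_Diff_subset finite_subset)
  qed
  have le: "card (supp A i) \<le> n" for A i
    using card_mono[of "{..<n}" "supp A i"] by (auto simp: supp_def)
  have "bij_betw enc X {A \<in> hanna_matrices n. \<forall>i < 2. ones_in_row A i = n - k}"
  proof (rule bij_betw_byWitness[where f' = "\<lambda>A. (supp A 0, supp A 1, threes A 0, threes A 1)"])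
    have "supp (enc (T, R, V, W)) 0 = T" "supp (enc (T, R, V, W)) 1 = R"
      "threes (enc (T, R, V, W)) 0 = V" "threes (enc (T, R, V, W)) 1 = W"
      if "(T, R, V, W) \<in> X" for T R V W
    proof -
      from that have "T \<subseteq> {..<n}" "R \<subseteq> {..<n}" "V \<subseteq> T" "W \<subseteq> R"
        by (auto simp: X_def k_subsets_def)
      moreover have "supp (enc (T, R, V, W)) i = {j. j < n \<and> (if i = 0 then j \<in> T else j \<in> R)}"
        "threes (enc (T, R, V, W)) i = {j. j < n \<and> (if i = 0 then j \<in> T \<inter> V else j \<in> R \<inter> W)}"
        if "i < 2" for i
        using that by (auto simp: supp_def threes_def enc_def entry_def split: if_splits)
      ultimately show "supp (enc (T, R, V, W)) 0 = T" "supp (enc (T, R, V, W)) 1 = R"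
        "threes (enc (T, R, V, W)) 0 = V" "threes (enc (T, R, V, W)) 1 = W"
        by auto
    qed
    note dec = this
    show "\<forall>a\<in>X. (supp (enc a) 0, supp (enc a) 1, threes (enc a) 0, threes (enc a) 1) = a"
      using dec by auto
    show "enc ` X \<subseteq> {A \<in> hanna_matrices n. \<forall>i < 2. ones_in_row A i = n - k}"
    proof safe
      fix T R V W assume x: "(T, R, V, W) \<in> X"
      have c: "enc (T, R, V, W) \<in> carrier_mat 2 n" by (simp add: enc_def)
      have r: "ones_in_row (enc (T, R, V, W)) 0 = n - k" "ones_in_row (enc (T, R, V, W)) 1 = n - k"
        using dec[OF x] x by (simp_all add: ones[OF c] X_def k_subsets_def)
      then show "enc (T, R, V, W) \<in> hanna_matrices n"
        using c by (auto simp: hanna_matrices_def enc_def entry_def)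
      fix i :: nat assume "i < 2"
      then show "ones_in_row (enc (T, R, V, W)) i = n - k"
        using r by (auto simp: less_2_cases_iff)
    qed
    have A: "A \<in> carrier_mat 2 n" "\<And>i j. i < 2 \<Longrightarrow> j < n \<Longrightarrow> A $$ (i, j) \<in> {1, 2, 3}"
      "\<And>i. i < 2 \<Longrightarrow> card (supp A i) = k"
      if "A \<in> hanna_matrices n" "\<forall>i < 2. ones_in_row A i = n - k" for A
    proof -
      show c: "A \<in> carrier_mat 2 n" "\<And>i j. i < 2 \<Longrightarrow> j < n \<Longrightarrow> A $$ (i, j) \<in> {1, 2, 3}"
        using that(1) unfolding hanna_matrices_def by blast+
      show "card (supp A i) = k" if "i < 2" for i
        using \<open>\<forall>i < 2. ones_in_row A i = n - k\<close> that ones[OF c(1), of i] le[of A i] assms by auto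
    qed
    show "\<forall>A\<in>{A \<in> hanna_matrices n. \<forall>i < 2. ones_in_row A i = n - k}.
        enc (supp A 0, supp A 1, threes A 0, threes A 1) = A"
    proof safe
      fix A assume "A \<in> hanna_matrices n" "\<forall>i < 2. ones_in_row A i = n - k"
      note A = A[OF this]
      show "enc (supp A 0, supp A 1, threes A 0, threes A 1) = A"
      proof (rule eq_matI)
        fix i j assume "i < dim_row A" "j < dim_col A"
        then have "i < 2" "j < n" using A(1) by auto
        then show "enc (supp A 0, supp A 1, threes A 0, threes A 1) $$ (i, j) = A $$ (i, j)"
          using A(2)[of i j]
          by (auto simp: enc_def entry_def supp_def threes_def less_2_cases_iff)
      qed (use A(1) in \<open>auto simp: enc_def\<close>)
    qed
    show "(\<lambda>A. (supp A 0, supp A 1, threes A 0, threes A 1)) `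
        {A \<in> hanna_matrices n. \<forall>i < 2. ones_in_row A i = n - k} \<subseteq> X"
    proof safe
      fix A assume "A \<in> hanna_matrices n" "\<forall>i < 2. ones_in_row A i = n - k"
      note A = A[OF this]
      show "(supp A 0, supp A 1, threes A 0, threes A 1) \<in> X"
        using A(3)[of 0] A(3)[of 1] by (auto simp: X_def k_subsets_def supp_def threes_def)
    qed
  qed
  then have "card {A \<in> hanna_matrices n. \<forall>i < 2. ones_in_row A i = n - k} = card X"
    by (rule bij_betw_same_card[symmetric])
  also have "\<dots> = (n choose k)\<^sup>2 * 4 ^ k"
  proof -
    have "finite (Pow T \<times> Pow R) \<and> card (Pow T \<times> Pow R) = 4 ^ k"
      if "T \<in> k_subsets {..<n} k" "R \<in> k_subsets {..<n} k" for T R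
    proof -
      have "finite T" "finite R" "card T = k" "card R = k"
        using that by (auto simp: k_subsets_def intro: finite_subset)
      then show ?thesis
        by (simp add: card_cartesian_product card_Pow flip: power_mult_distrib)
    qed
    then show ?thesis
      unfolding X_def by (subst card_k_subsets_pairs) auto
  qed
  finally show ?thesis .
qed

section \<open>Deals\<close>

lemma UNIV_color: "UNIV = {Red, Green, Blue}"
  using color.exhaust by auto

text \<open>
  A deal amounts to the set \<open>S\<close> of denominations, red's hand \<open>A\<close> and the set \<open>B\<close> of denominations
  whose red card goes to green. The rest is forced: a green card outside red's hand goes
  to blue, and a blue card outside red's hand goes to green.
\<close>

definition deal_codes :: "nat \<Rightarrow> (nat set \<times> (color \<times> nat) set \<times> nat set) set" where
  "deal_codes n = {(S, A, B). S \<subseteq> {1..n} \<and> A \<subseteq> {Green, Blue} \<times> S \<and> card A = card S \<and> B \<subseteq> S}"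

fun deal :: "nat set \<times> (color \<times> nat) set \<times> nat set \<Rightarrow> color \<Rightarrow> (color \<times> nat) set" where
  "deal (S, A, B) Red = A"
| "deal (S, A, B) Green = {Red} \<times> B \<union> ({Blue} \<times> S - A)"
| "deal (S, A, B) Blue = {Red} \<times> (S - B) \<union> ({Green} \<times> S - A)"

lemma bij_betw_deal: "bij_betw deal (deal_codes n) (hanna_deals n)"
proof (rule bij_betw_byWitness[where
      f' = "\<lambda>h. (snd ` (\<Union>c. h c), h Red, {d. (Red, d) \<in> h Green})"])
  have union: "(\<Union>c. deal (S, A, B) c) = UNIV \<times> S" if "(S, A, B) \<in> deal_codes n" for S A B
    using that by (auto simp: deal_codes_def UNIV_color)
  show "\<forall>a\<in>deal_codes n. (snd ` (\<Union>c. deal a c), deal a Red, {d. (Red, d) \<in> deal a Green}) = a"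
  proof
    fix a assume a: "a \<in> deal_codes n"
    obtain S A B where [simp]: "a = (S, A, B)" by (cases a)
    show "(snd ` (\<Union>c. deal a c), deal a Red, {d. (Red, d) \<in> deal a Green}) = a"
      using a union[of S A B] by (auto simp: deal_codes_def)
  qed
  show "deal ` deal_codes n \<subseteq> hanna_deals n"
  proof safe
    fix S A B assume code: "(S, A, B) \<in> deal_codes n"
    have "deal (S, A, B) c \<inter> deal (S, A, B) c' = {}" if "c \<noteq> c'" for c c'
      using that code by (cases c; cases c') (auto simp: deal_codes_def)
    moreover have "(c, d) \<notin> deal (S, A, B) c" for c d
      using code by (cases c) (auto simp: deal_codes_def)
    ultimately show "deal (S, A, B) \<in> hanna_deals n"
      using union[OF code] code unfolding hanna_deals_def deal_codes_def by auto
  qed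
  have hands: "(snd ` (\<Union>c. h c), h Red, {d. (Red, d) \<in> h Green}) \<in> deal_codes n \<and>
      deal (snd ` (\<Union>c. h c), h Red, {d. (Red, d) \<in> h Green}) = h"
    if deal: "h \<in> hanna_deals n" for h
  proof -
    obtain S where h: "S \<subseteq> {1..n}" "(\<Union>c. h c) = UNIV \<times> S"
      "\<forall>c c'. c \<noteq> c' \<longrightarrow> h c \<inter> h c' = {}" "\<forall>c d. (c, d) \<notin> h c" "card (h Red) = card S"
      using deal unfolding hanna_deals_def by blast
    have S: "snd ` (\<Union>c. h c) = S" unfolding h(2) by auto
    have mem: "d \<in> S" if "(c, d) \<in> h c'" for c d c'
    proof -
      have "(c, d) \<in> (\<Union>c. h c)" using that by blast
      then show ?thesis by (simp add: h(2))
    qed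
    have own: "(c, d) \<notin> h c" for c d
      using h(4) by blast
    have disj: "x \<notin> h c'" if "x \<in> h c" "c \<noteq> c'" for x c c'
      using that h(3) by blast
    have ex: "(c, d) \<in> h Red \<or> (c, d) \<in> h Green \<or> (c, d) \<in> h Blue" if "d \<in> S" for c d
    proof -
      have "(c, d) \<in> (\<Union>c. h c)" using h(2) that by simp
      then show ?thesis by (simp add: UNIV_color)
    qed
    have "c \<noteq> Red \<and> d \<in> S" if "(c, d) \<in> h Red" for c d
      using that own mem by auto
    moreover have "c \<in> {Green, Blue}" if "c \<noteq> Red" for c
      using that by (cases c) auto
    ultimately have "h Red \<subseteq> {Green, Blue} \<times> S"
      by auto
    then have "(S, h Red, {d. (Red, d) \<in> h Green}) \<in> deal_codes n"
      using h(1,5) mem unfolding deal_codes_def by auto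
    moreover have "deal (S, h Red, {d. (Red, d) \<in> h Green}) = h"
    proof
      fix c
      have "x \<in> deal (S, h Red, {d. (Red, d) \<in> h Green}) c \<longleftrightarrow> x \<in> h c" for x
      proof -
        obtain c' d where x: "x = (c', d)" by (cases x)
        show ?thesis
          unfolding x using own[of c' d] mem[of c' d] ex[of d c']
            disj[of "(c', d)" Red Green] disj[of "(c', d)" Red Blue] disj[of "(c', d)" Green Blue]
          by (cases c; cases c') auto
      qed
      then show "deal (S, h Red, {d. (Red, d) \<in> h Green}) c = h c" by blast
    qed
    ultimately show ?thesis unfolding S ..
  qed
  show "\<forall>h\<in>hanna_deals n. deal (snd ` (\<Union>c. h c), h Red, {d. (Red, d) \<in> h Green}) = h"
    using hands by simp
  show "(\<lambda>h. (snd ` (\<Union>c. h c), h Red, {d. (Red, d) \<in> h Green})) ` hanna_deals n \<subseteq> deal_codes n"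
    using hands by auto
qed

lemma finite_hanna_deals: "finite (hanna_deals n)"
proof -
  have "deal_codes n \<subseteq> Pow {1..n} \<times> Pow ({Green, Blue} \<times> {1..n}) \<times> Pow {1..n}"
    by (auto simp: deal_codes_def)
  then have "finite (deal_codes n)"
    by (rule finite_subset) auto
  then show ?thesis
    using bij_betw_finite[OF bij_betw_deal] by blast
qed

text \<open>
  Red chooses \<open>k\<close> of the \<open>2 k\<close> green and blue cards, and each of the \<open>k\<close> red cards has two possible
  recipients.
\<close>

lemma card_hanna_deals_by_size:
  "card {h \<in> hanna_deals n. card (h Red) = k} = (n choose k) * ((2 * k) choose k) * 2 ^ k"
proof -
  have "card {h \<in> hanna_deals n. card (h Red) = k} = card {t \<in> deal_codes n. card (deal t Red) = k}"
    by (rule card_filter_bij_betw[OF bij_betw_deal])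
  also have "{t \<in> deal_codes n. card (deal t Red) = k} =
      (SIGMA S:k_subsets {1..n} k. k_subsets ({Green, Blue} \<times> S) k \<times> Pow S)"
    by (auto simp: deal_codes_def k_subsets_def)
  also have "card \<dots> = (\<Sum>S\<in>k_subsets {1..n} k. ((2 * k) choose k) * 2 ^ k)"
  proof (subst card_SigmaI)
    have "finite S \<and> card S = k" if "S \<in> k_subsets {1..n} k" for S
      using that by (auto simp: k_subsets_def intro: finite_subset)
    then show "\<forall>S\<in>k_subsets {1..n} k. finite (k_subsets ({Green, Blue} \<times> S) k \<times> Pow S)"
      "(\<Sum>S\<in>k_subsets {1..n} k. card (k_subsets ({Green, Blue} \<times> S) k \<times> Pow S)) =
        (\<Sum>S\<in>k_subsets {1..n} k. ((2 * k) choose k) * 2 ^ k)"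
      by (auto simp: finite_k_subsets card_cartesian_product card_k_subsets card_Pow
          simp flip: mult_2 intro!: sum.cong)
  qed (simp add: finite_k_subsets)
  also have "\<dots> = (n choose k) * ((2 * k) choose k) * 2 ^ k"
    by (simp add: card_k_subsets)
  finally show ?thesis .
qed

lemma card_green_blue:
  assumes "finite P" "finite Q"
  shows "card ({Green} \<times> P \<union> {Blue} \<times> Q) = card P + card Q"
  using assms by (subst card_Un_disjoint) (auto simp: card_cartesian_product)

text \<open>
  Let \<open>T\<close> be the set of denominations in red's hand, and let \<open>R\<close> be the set of dealt denominations
  of which red does not hold both the green and the blue card. Then \<open>S = T \<union> R\<close>, and red holds both
  cards exactly for the denominations in \<open>T - R\<close>, so her hand has
  \<open>card T + card (T - R)\<close> cards. This equals \<open>card (T \<union> R) = card R + card (T - R)\<close> precisely when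
  \<open>card T = card R\<close>. So deals correspond to two arbitrary \<open>k\<close>-subsets \<open>T\<close>, \<open>R\<close>, the
  subset \<open>V\<close> of \<open>T \<inter> R\<close> where red holds the green card rather than the blue one, and the
  subset \<open>B\<close> of \<open>T \<union> R\<close> where the red card goes to green. As \<open>card (T \<inter> R) + card (T \<union> R) = 2 k\<close>,
  each pair \<open>(T, R)\<close> accounts for \<open>2\<^bsup>2 k\<^esup>\<close> deals.
\<close>

lemma card_hanna_deals_by_denominations:
  "card {h \<in> hanna_deals n. card (snd ` h Red) = k} = (n choose k)\<^sup>2 * 4 ^ k"
proof -
  define X where "X = (SIGMA T:k_subsets {1..n} k. SIGMA R:k_subsets {1..n} k.
    Pow (T \<inter> R) \<times> Pow (T \<union> R))"
  define f where "f = (\<lambda>(T :: nat set, R, V, B :: nat set).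
    (T \<union> R, {Green} \<times> (T - R \<union> V) \<union> {Blue} \<times> (T - V), B))"
  define R_of where "R_of = (\<lambda>(S :: nat set) A. {d \<in> S. \<not> ((Green, d) \<in> A \<and> (Blue, d) \<in> A)})"
  define g where "g = (\<lambda>(S, A, B :: nat set).
    (snd ` A, R_of S A, {d \<in> snd ` A \<inter> R_of S A. (Green, d) \<in> A}, B))"
  let ?D = "{t \<in> deal_codes n. card (snd ` deal t Red) = k}"
  have "bij_betw f X ?D"
  proof (rule bij_betw_byWitness[where f' = g])
    have img: "snd ` ({Green} \<times> (T - R \<union> V) \<union> {Blue} \<times> (T - V)) = T"
      if "V \<subseteq> T \<inter> R" for T R V :: "nat set"
      unfolding image_Un snd_image_times using that by auto
    show "\<forall>t\<in>X. g (f t) = t"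
    proof
      fix t assume tX: "t \<in> X"
      obtain T R V B where t: "t = (T, R, V, B)" by (cases t)
      then have V: "V \<subseteq> T \<inter> R" using tX by (simp add: X_def)
      define A where "A = {Green} \<times> (T - R \<union> V) \<union> {Blue} \<times> (T - V)"
      have mem: "(Green, d) \<in> A \<longleftrightarrow> d \<in> T - R \<union> V" "(Blue, d) \<in> A \<longleftrightarrow> d \<in> T - V" for d
        by (simp_all add: A_def)
      have "snd ` A = T" using img[OF V] by (simp add: A_def)
      moreover have "R_of (T \<union> R) A = R"
        unfolding R_of_def mem using V by blast
      moreover have "{d \<in> T \<inter> R. (Green, d) \<in> A} = V"
        unfolding mem using V by blast
      ultimately show "g (f t) = t"
        by (simp add: t g_def f_def flip: A_def)
    qed
    show "f ` X \<subseteq> ?D"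
    proof (rule image_subsetI)
      fix t assume tX: "t \<in> X"
      obtain T R V B where t: "t = (T, R, V, B)" by (cases t)
      have sub: "T \<subseteq> {1..n}" "R \<subseteq> {1..n}" "V \<subseteq> T \<inter> R" "B \<subseteq> T \<union> R"
        and card: "card T = k" "card R = k"
        using tX by (auto simp: t X_def k_subsets_def)
      have fin: "finite T" "finite R" "finite V"
        using finite_subset[OF sub(1)] finite_subset[OF sub(2)] finite_subset[OF sub(3)] by simp_all
      have "card ({Green} \<times> (T - R \<union> V) \<union> {Blue} \<times> (T - V)) = card (T - R \<union> V) + card (T - V)"
        using fin by (simp add: card_green_blue)
      also have "card (T - R \<union> V) = card (T - R) + card V"
        using fin sub by (intro card_Un_disjoint) auto
      also have "card (T - V) = card T - card V"
        using fin sub by (intro card_Diff_subset) auto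
      also have "card (T - R) + card V + (card T - card V) = card (T - R) + card T"
        using card_mono[of T V] fin sub by auto
      also have "\<dots> = card (T - R) + card R"
        using card by simp
      also have "\<dots> = card (T \<union> R)"
        using card_Un_disjoint[of "T - R" R] fin by (simp add: Int_commute)
      finally have "f t \<in> deal_codes n"
        using sub by (simp add: t f_def deal_codes_def) blast
      moreover have "card (snd ` deal (f t) Red) = k"
        using img[OF sub(3)] card by (simp add: t f_def)
      ultimately show "f t \<in> ?D" by simp
    qed
    \<comment> \<open>\<open>P\<close> and \<open>Q\<close> are the denominations of red's green and blue cards.\<close>
    have code: "\<exists>P Q. A = {Green} \<times> P \<union> {Blue} \<times> Q \<and> P \<subseteq> S \<and> Q \<subseteq> S \<and> finite S \<and> snd ` A = P \<union> Q
        \<and> R_of S A = S - P \<inter> Q \<and> card (R_of S A) = card (P \<union> Q)"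
      if "(S, A, B) \<in> deal_codes n" for S A B
    proof -
      define P Q where "P = {d. (Green, d) \<in> A}" and "Q = {d. (Blue, d) \<in> A}"
      have A: "A = {Green} \<times> P \<union> {Blue} \<times> Q" "P \<subseteq> S" "Q \<subseteq> S" and fin: "finite S"
        using that by (auto simp: deal_codes_def P_def Q_def intro: finite_subset)
      have fPQ: "finite P" "finite Q" using A fin by (auto intro: finite_subset)
      have "card S = card P + card Q"
        using that card_green_blue[OF fPQ] A(1) by (simp add: deal_codes_def)
      moreover have "card P + card Q = card (P \<union> Q) + card (P \<inter> Q)"
        by (rule card_Un_Int[OF fPQ])
      moreover have "card (S - P \<inter> Q) = card S - card (P \<inter> Q)"
        using A fPQ by (intro card_Diff_subset) auto
      moreover have "R_of S A = S - P \<inter> Q"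
        by (auto simp: R_of_def P_def Q_def)
      moreover have "snd ` A = P \<union> Q"
        unfolding A(1) image_Un by simp
      ultimately show ?thesis
        using A fin by (intro exI[of _ P] exI[of _ Q]) simp
    qed
    show "\<forall>t\<in>?D. f (g t) = t"
    proof
      fix t assume "t \<in> ?D"
      then obtain S A B where t: "t = (S, A, B)" "(S, A, B) \<in> deal_codes n"
        by (cases t) auto
      from code[OF t(2)] obtain P Q where A: "A = {Green} \<times> P \<union> {Blue} \<times> Q" "P \<subseteq> S" "Q \<subseteq> S"
        and T: "snd ` A = P \<union> Q" and R: "R_of S A = S - P \<inter> Q"
        by blast
      have V: "{d \<in> (P \<union> Q) \<inter> (S - P \<inter> Q). (Green, d) \<in> A} = P - Q"
        using A by auto
      have "P \<union> Q - (S - P \<inter> Q) \<union> (P - Q) = P" "P \<union> Q - (P - Q) = Q"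
        "P \<union> Q \<union> (S - P \<inter> Q) = S"
        using A(2,3) by auto
      then show "f (g t) = t"
        by (simp only: t(1) g_def f_def prod.case T R V A(1)[symmetric])
    qed
    show "g ` ?D \<subseteq> X"
    proof (rule image_subsetI)
      fix t assume tD: "t \<in> ?D"
      obtain S A B where t: "t = (S, A, B)" by (cases t)
      have tc: "(S, A, B) \<in> deal_codes n" and k: "card (snd ` A) = k"
        using tD by (simp_all add: t)
      from code[OF tc] have "R_of S A \<subseteq> S" "snd ` A \<subseteq> S" "card (R_of S A) = card (snd ` A)"
        "snd ` A \<union> R_of S A = S"
        by auto
      moreover have "S \<subseteq> {1..n}" "B \<subseteq> S"
        using tc by (auto simp: deal_codes_def)
      ultimately show "g t \<in> X"
        using k by (simp add: t g_def X_def k_subsets_def) auto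
    qed
  qed
  then have "card {h \<in> hanna_deals n. card (snd ` h Red) = k} = card X"
    by (simp add: card_filter_bij_betw[OF bij_betw_deal] bij_betw_same_card)
  also have "\<dots> = (n choose k)\<^sup>2 * 4 ^ k"
  proof -
    have "finite (Pow (T \<inter> R) \<times> Pow (T \<union> R)) \<and> card (Pow (T \<inter> R) \<times> Pow (T \<union> R)) = 4 ^ k"
      if "T \<in> k_subsets {1..n} k" "R \<in> k_subsets {1..n} k" for T R
    proof -
      have fin: "finite T" "finite R" and "card T = k" "card R = k"
        using that by (auto simp: k_subsets_def intro: finite_subset)
      then have "card (T \<inter> R) + card (T \<union> R) = 2 * k"
        using card_Un_Int[of T R] by simp
      then have "2 ^ card (T \<inter> R) * 2 ^ card (T \<union> R) = (4 :: nat) ^ k"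
        by (simp add: power_mult flip: power_add)
      then show ?thesis
        using fin by (simp add: card_cartesian_product card_Pow del: Pow_Int_eq)
    qed
    then show ?thesis
      unfolding X_def by (subst card_k_subsets_pairs) auto
  qed
  finally show ?thesis .
qed

text \<open>
  Both sums count all deals, once by the size of red's hand and once by its number of distinct
  denominations.
\<close>

lemma sum_by_size_eq_sum_by_denominations:
  "(\<Sum>k=0..n. (n choose k) * ((2 * k) choose k) * 2 ^ k) = (\<Sum>k=0..n. (n choose k)\<^sup>2 * 4 ^ k)"
proof -
  have bound: "card (h Red) \<le> n" "card (snd ` h Red) \<le> card (h Red)" if deal: "h \<in> hanna_deals n" for h
  proof -
    obtain S where S: "S \<subseteq> {1..n}" "(\<Union>c. h c) = UNIV \<times> S" "card (h Red) = card S"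
      using deal unfolding hanna_deals_def by blast
    have "h Red \<subseteq> UNIV \<times> S"
      unfolding S(2)[symmetric] by (rule UN_upper) simp
    then have "finite (h Red)"
      by (rule finite_subset) (use S(1) in \<open>auto simp: UNIV_color intro: finite_subset\<close>)
    then show "card (snd ` h Red) \<le> card (h Red)" by (rule card_image_le)
    show "card (h Red) \<le> n"
      using S card_mono[of "{1..n}" S] by simp
  qed
  have "(\<Sum>k=0..n. card {h \<in> hanna_deals n. card (h Red) = k}) = card (hanna_deals n)"
    by (rule sum_card_fibres[OF finite_hanna_deals bound(1)])
  moreover have "(\<Sum>k=0..n. card {h \<in> hanna_deals n. card (snd ` h Red) = k}) = card (hanna_deals n)"
    by (rule sum_card_fibres[OF finite_hanna_deals order_trans[OF bound(2) bound(1)]])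
  ultimately show ?thesis
    by (simp only: card_hanna_deals_by_size card_hanna_deals_by_denominations)
qed

section \<open>Matching pairs of slanted steps\<close>

definition positions :: "step list \<Rightarrow> step \<Rightarrow> nat set" where
  "positions w s = {i. i < length w \<and> w ! i = s}"

lemma finite_positions [simp]: "finite (positions w s)"
  unfolding positions_def by simp

lemma card_positions: "card (positions w s) = count_list w s"
  unfolding positions_def by (rule count_list_conv_card[symmetric])

lemma positions_disjoint: "s \<noteq> t \<Longrightarrow> positions w s \<inter> positions w t = {}"
  by (auto simp: positions_def)

lemma UNIV_step: "UNIV = {Up, Down, Flat}"
  using step.exhaust by auto

lemma count_steps: "count_list w Up + count_list w Down + count_list w Flat = length w"
proof (induction w)
  case (Cons s w)
  then show ?case by (cases s) auto
qed simp

lemma height_Suc: "i < length w \<Longrightarrow> height w (Suc i) = height w i + rise (w ! i)"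
  by (simp add: height_def take_Suc_conv_app_nth)

lemma height_length:
  assumes "delannoy_path w"
  shows "height w (length w) = 0"
proof -
  have "(\<Sum>s\<leftarrow>w. rise s) = int (count_list w Up) - int (count_list w Down)" for w
  proof (induction w)
    case (Cons s w)
    then show ?case by (cases s) auto
  qed simp
  then show ?thesis
    using assms by (simp add: height_def delannoy_path_def)
qed

text \<open>
  The discrete intermediate value theorem: a path steps down by at most one unit, so it cannot get
  from above height \<open>h\<close> to \<open>h\<close> or below without a downstep from \<open>h + 1\<close> to \<open>h\<close>. It provides both the
  existence of matching downsteps and the injectivity of the matching.
\<close>

lemma down_crossing:
  assumes "a \<le> b" "b \<le> length w" "h < height w a" "height w b \<le> h"
  shows "\<exists>m. a \<le> m \<and> m < b \<and> down_from w (h + 1) m"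
  using assms
proof (induction b rule: dec_induct)
  case base
  then show ?case by simp
next
  case (step b)
  show ?case
  proof (cases "height w b \<le> h")
    case True
    then show ?thesis using step by (meson Suc_leD less_SucI)
  next
    case False
    then have "w ! b = Down \<and> height w b = h + 1"
      using step.prems height_Suc[of b w] by (cases "w ! b") auto
    then show ?thesis
      using step by (auto simp: down_from_def)
  qed
qed

text \<open>
  An upstep from height \<open>h \<ge> 0\<close> is followed by a return to ground level, which crosses from
  \<open>h + 1\<close> to \<open>h\<close>; an upstep from \<open>h < 0\<close> is preceded by a descent from ground level, which makes the
  same crossing.
\<close>

lemma matched_ex:
  assumes w: "delannoy_path w" and i: "i \<in> positions w Up"
  shows "\<exists>j. matched w i j"
proof -
  define h where "h = height w i"
  define D where "D = down_from w (h + 1)"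
  have up: "i < length w" "w ! i = Up" "height w (Suc i) = h + 1"
    using i by (auto simp: positions_def h_def height_Suc)
  show ?thesis
  proof (cases "h \<ge> 0")
    case True
    have "\<exists>m. Suc i \<le> m \<and> m < length w \<and> D m"
      unfolding D_def by (rule down_crossing) (use up True height_length[OF w] in auto)
    then have "\<exists>m. i < m \<and> D m" by (auto simp: Suc_le_eq)
    then have "i < (LEAST m. i < m \<and> D m) \<and> D (LEAST m. i < m \<and> D m)"
      by (rule LeastI_ex)
    moreover have "\<not> D m" if "i < m" "m < (LEAST m. i < m \<and> D m)" for m
      using not_less_Least[OF that(2)] that(1) by blast
    ultimately show ?thesis
      using up True unfolding matched_def h_def[symmetric] D_def[symmetric] by auto
  next
    case False
    have "\<exists>m. 0 \<le> m \<and> m < i \<and> D m"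
      unfolding D_def by (rule down_crossing) (use up False in \<open>auto simp: height_def h_def\<close>)
    then have ne: "{m. m < i \<and> D m} \<noteq> {}" by auto
    define j where "j = Max {m. m < i \<and> D m}"
    have fin: "finite {m. m < i \<and> D m}" by simp
    have "j < i \<and> D j"
      using Max_in[OF fin ne] by (simp add: j_def)
    moreover have "\<not> D m" if "j < m" "m < i" for m
      using Max_ge[OF fin, of m] that unfolding j_def[symmetric] by auto
    ultimately show ?thesis
      using up False unfolding matched_def h_def[symmetric] D_def[symmetric] by auto
  qed
qed

lemma matched_unique: "matched w i j \<Longrightarrow> matched w i j' \<Longrightarrow> j = j'"
  unfolding matched_def by (cases j j' rule: linorder_cases) (auto split: if_splits)

text \<open>
  Two upsteps sharing a downstep start at the same height, namely one below that of the downstep.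
  Between them the path must descend from \<open>h + 1\<close> to \<open>h\<close>, and this downstep is nearer to one of them.
\<close>

lemma matched_inj:
  assumes "matched w i j" "matched w i' j"
  shows "i = i'"
proof -
  have False if m: "matched w i j" "matched w i' j" and less: "i < i'" for i i'
  proof -
    define h where "h = height w i"
    have h: "height w i' = h" "height w (Suc i) = h + 1" and i': "i' < length w"
      using m by (auto simp: matched_def down_from_def h_def height_Suc)
    have "\<exists>m. Suc i \<le> m \<and> m < i' \<and> down_from w (h + 1) m"
      by (rule down_crossing) (use h i' less in auto)
    then obtain m where "i < m" "m < i'" "down_from w (h + 1) m"
      by (auto simp: Suc_le_eq)
    then show False
      using \<open>matched w i j\<close> \<open>matched w i' j\<close> less h(1)
      unfolding matched_def h_def[symmetric] by (cases "h \<ge> 0") (auto dest: less_trans)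
  qed
  then show ?thesis
    using assms by (meson linorder_neqE_nat)
qed

definition partner :: "step list \<Rightarrow> nat \<Rightarrow> nat" where
  "partner w i = (THE j. matched w i j)"

lemma matched_iff:
  assumes "delannoy_path w"
  shows "matched w i j \<longleftrightarrow> i \<in> positions w Up \<and> j = partner w i"
proof
  assume m: "matched w i j"
  then have "partner w i = j"
    unfolding partner_def by (blast intro: the_equality matched_unique)
  then show "i \<in> positions w Up \<and> j = partner w i"
    using m by (auto simp: matched_def positions_def)
next
  assume i: "i \<in> positions w Up \<and> j = partner w i"
  then obtain j' where "matched w i j'"
    using matched_ex assms by blast
  then have "matched w i (partner w i)"
    unfolding partner_def by (blast intro: theI matched_unique)
  then show "matched w i j" using i by simp
qed

text \<open>
  The matching is onto because it is injective and there are as many downsteps as upsteps.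
\<close>

lemma bij_betw_partner:
  assumes "delannoy_path w"
  shows "bij_betw (partner w) (positions w Up) (positions w Down)"
proof -
  have "inj_on (partner w) (positions w Up)"
    using matched_inj matched_iff[OF assms] by (metis inj_onI)
  moreover have "partner w ` positions w Up \<subseteq> positions w Down"
    using matched_iff[OF assms] by (auto simp: matched_def down_from_def positions_def)
  moreover have "card (positions w Up) = card (positions w Down)"
    using assms by (simp add: card_positions delannoy_path_def)
  ultimately show ?thesis
    by (simp add: bij_betw_def card_image card_subset_eq)
qed

lemma pairs_not_both_1_eq:
  assumes "delannoy_path (map fst p)"
  shows "pairs_not_both_1 p = card {i \<in> positions (map fst p) Up.
    \<not> (snd (p ! i) = 1 \<and> snd (p ! partner (map fst p) i) = 1)}" (is "_ = card ?A")
proof -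
  have "{(i, j). matched (map fst p) i j \<and> \<not> (snd (p ! i) = 1 \<and> snd (p ! j) = 1)} =
      (\<lambda>i. (i, partner (map fst p) i)) ` ?A"
    by (auto simp: matched_iff[OF assms])
  then show ?thesis
    by (simp add: pairs_not_both_1_def card_image inj_on_def)
qed

lemma flats_above_2_eq: "flats_above_2 p = card {i \<in> positions (map fst p) Flat. snd (p ! i) > 2}"
  unfolding flats_above_2_def positions_def by (rule arg_cong[where f = card]) auto

section \<open>Labelings and paths\<close>

definition labelings :: "step list \<Rightarrow> (step \<times> nat) list set" where
  "labelings w = {p. map fst p = w \<and> (\<forall>(s, l)\<in>set p. l \<in> step_labels s)}"

abbreviation weight :: "(step \<times> nat) list \<Rightarrow> nat" where
  "weight p \<equiv> pairs_not_both_1 p + flats_above_2 p"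

lemma labelings_iff:
  "p \<in> labelings w \<longleftrightarrow> map fst p = w \<and> (\<forall>i<length w. snd (p ! i) \<in> step_labels (w ! i))"
  unfolding labelings_def by (auto simp: all_set_conv_all_nth case_prod_beta)

text \<open>
  A labeling of a word splits into independent units: one for each matching pair, placed at its
  upstep and carrying the labels of the upstep and its partner, and one for each flatstep, with a dummy second
  component \<open>0\<close>.
\<close>

definition unit_labels :: "step list \<Rightarrow> nat \<Rightarrow> (nat \<times> nat) set" where
  "unit_labels w i = (if w ! i = Up then {1, 2} \<times> {1, 2} else {1, 2, 3, 4, 5} \<times> {0})"

lemma bij_betw_unit_labels:
  assumes w: "delannoy_path w"
  shows "bij_betw
    (\<lambda>p. \<lambda>i\<in>positions w Up \<union> positions w Flat.
      (snd (p ! i), if w ! i = Up then snd (p ! partner w i) else 0))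
    (labelings w) (PiE (positions w Up \<union> positions w Flat) (unit_labels w))"
    (is "bij_betw ?c _ (PiE ?I _)")
proof -
  define r where "r = inv_into (positions w Up) (partner w)"
  define d where "d = (\<lambda>q :: nat \<Rightarrow> nat \<times> nat.
    map (\<lambda>i. (w ! i, if w ! i = Down then snd (q (r i)) else fst (q i))) [0..<length w])"
  have partner: "partner w i < length w" "w ! partner w i = Down" "r (partner w i) = i"
    if "i < length w" "w ! i = Up" for i
    using that bij_betw_partner[OF w]
    by (auto simp: bij_betw_def positions_def r_def inv_into_f_f dest!: equalityD1)
  have r: "r j < length w" "w ! r j = Up" "partner w (r j) = j"
    if "j < length w" "w ! j = Down" for j
  proof -
    have j: "j \<in> partner w ` positions w Up"
      using that bij_betw_partner[OF w] by (auto simp: bij_betw_def positions_def)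
    show "r j < length w" "w ! r j = Up" "partner w (r j) = j"
      using inv_into_into[OF j] f_inv_into_f[OF j] by (auto simp: r_def positions_def)
  qed
  show ?thesis
  proof (rule bij_betw_byWitness[where f' = d])
    show "\<forall>p\<in>labelings w. d (?c p) = p"
    proof
      fix p assume p: "p \<in> labelings w"
      then have len: "length p = length w" and fst: "\<And>i. i < length w \<Longrightarrow> fst (p ! i) = w ! i"
        by (auto simp: labelings_def)
      show "d (?c p) = p"
      proof (rule nth_equalityI)
        fix i assume "i < length (d (?c p))"
        then have i: "i < length w" by (simp add: d_def)
        show "d (?c p) ! i = p ! i"
          using i fst[OF i] r[OF i]
          by (cases "w ! i") (auto simp: d_def positions_def prod_eq_iff)
      qed (simp add: d_def len)
    qed
    show "\<forall>q\<in>PiE ?I (unit_labels w). ?c (d q) = q"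
    proof
      fix q assume q: "q \<in> PiE ?I (unit_labels w)"
      show "?c (d q) = q"
      proof
        fix i
        show "?c (d q) i = q i"
        proof (cases "i \<in> ?I")
          case False
          then show ?thesis using q by (auto simp: PiE_def extensional_def)
        next
          case True
          then have "q i \<in> unit_labels w i" using q by auto
          then show ?thesis
            using True partner[of i]
            by (auto simp: d_def positions_def unit_labels_def prod_eq_iff)
        qed
      qed
    qed
    show "?c ` labelings w \<subseteq> PiE ?I (unit_labels w)"
    proof (rule image_subsetI)
      fix p assume "p \<in> labelings w"
      then have p: "snd (p ! i) \<in> step_labels (w ! i)" if "i < length w" for i
        using that by (auto simp: labelings_iff)
      show "?c p \<in> PiE ?I (unit_labels w)"
      proof (rule restrict_PiE_iff[THEN iffD2], rule ballI)
        fix i assume i: "i \<in> ?I"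
        then show "(snd (p ! i), if w ! i = Up then snd (p ! partner w i) else 0) \<in> unit_labels w i"
          using p[of i] p[of "partner w i"] partner[of i]
          by (auto simp: positions_def unit_labels_def)
      qed
    qed
    show "d ` PiE ?I (unit_labels w) \<subseteq> labelings w"
    proof (rule image_subsetI)
      fix q assume q: "q \<in> PiE ?I (unit_labels w)"
      have "snd (d q ! i) \<in> step_labels (w ! i)" if i: "i < length w" for i
      proof (cases "w ! i")
        case Up
        then have "q i \<in> unit_labels w i" using q i by (auto simp: positions_def)
        then show ?thesis using Up i by (auto simp: d_def unit_labels_def)
      next
        case Down
        then have "q (r i) \<in> unit_labels w (r i)"
          using q r[OF i] by (auto simp: positions_def)
        then show ?thesis using Down i r(2)[OF i] by (auto simp: d_def unit_labels_def)
      next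
        case Flat
        then have "q i \<in> unit_labels w i" using q i by (auto simp: positions_def)
        then show ?thesis using Flat i by (auto simp: d_def unit_labels_def)
      qed
      then show "d q \<in> labelings w"
        by (simp add: labelings_iff) (simp add: d_def comp_def map_nth)
    qed
  qed
qed

text \<open>
  The weight is the number of units carrying a factor \<open>Y\<close>, so the sum factors over the units. Of the
  four labelings of a matching pair three carry \<open>Y\<close>, and of the five labels of a flatstep three
  carry \<open>Y\<close>. At \<open>Y = 1\<close> this is the plain number of labelings.
\<close>

lemma sum_labelings:
  fixes Y :: "'a :: comm_semiring_1"
  assumes w: "delannoy_path w"
  shows "(\<Sum>p\<in>labelings w. Y ^ weight p) =
    (1 + 3 * Y) ^ count_list w Up * (2 + 3 * Y) ^ count_list w Flat"
proof -
  define I where "I = positions w Up \<union> positions w Flat"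
  define u :: "nat \<Rightarrow> nat \<times> nat \<Rightarrow> 'a" where "u = (\<lambda>i (a, b).
    if (if w ! i = Up then \<not> (a = 1 \<and> b = 1) else a > 2) then Y else 1)"
  define c where "c = (\<lambda>p :: (step \<times> nat) list. \<lambda>i\<in>I.
    (snd (p ! i), if w ! i = Up then snd (p ! partner w i) else 0))"
  have prod_I: "prod f I = prod f (positions w Up) * prod f (positions w Flat)" for f :: "nat \<Rightarrow> 'a"
    unfolding I_def by (rule prod.union_disjoint) (auto simp: positions_disjoint)
  have "Y ^ weight p = (\<Prod>i\<in>I. u i (c p i))" if "p \<in> labelings w" for p
  proof -
    have fst: "map fst p = w" using that by (simp add: labelings_def)
    have "(\<Prod>i\<in>positions w Up. u i (c p i)) = Y ^ pairs_not_both_1 p"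
      unfolding pairs_not_both_1_eq[of p, unfolded fst, OF w]
      by (subst prod_if_power[symmetric])
         (auto simp: u_def c_def I_def positions_def intro!: prod.cong)
    moreover have "(\<Prod>i\<in>positions w Flat. u i (c p i)) = Y ^ flats_above_2 p"
      unfolding flats_above_2_eq[of p, unfolded fst]
      by (subst prod_if_power[symmetric])
         (auto simp: u_def c_def I_def positions_def intro!: prod.cong)
    ultimately show ?thesis
      by (simp add: prod_I power_add)
  qed
  then have "(\<Sum>p\<in>labelings w. Y ^ weight p) = (\<Sum>p\<in>labelings w. \<Prod>i\<in>I. u i (c p i))"
    by (rule sum.cong[OF refl])
  also have "\<dots> = (\<Sum>q\<in>PiE I (unit_labels w). \<Prod>i\<in>I. u i (q i))"
    using bij_betw_unit_labels[OF w] unfolding I_def[symmetric] c_def[symmetric]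
    by (rule sum.reindex_bij_betw)
  also have "\<dots> = (\<Prod>i\<in>I. \<Sum>y\<in>unit_labels w i. u i y)"
    by (rule prod_sum_PiE[symmetric]) (auto simp: I_def unit_labels_def)
  also have "\<dots> = (1 + 3 * Y) ^ count_list w Up * (2 + 3 * Y) ^ count_list w Flat"
  proof -
    have three: "3 * Y = Y + Y + Y"
      using distrib_right[of "1 + 1" 1 Y] distrib_right[of 1 1 Y] by simp
    have "(\<Sum>y\<in>unit_labels w i. u i y) = 1 + 3 * Y" if "i \<in> positions w Up" for i
      using that unfolding three
      by (simp add: positions_def unit_labels_def u_def sum.cartesian_product[symmetric] add_ac)
    moreover have "(\<Sum>y\<in>unit_labels w i. u i y) = 2 + 3 * Y" if "i \<in> positions w Flat" for i
      using that unfolding three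
      by (simp add: positions_def unit_labels_def u_def sum.cartesian_product[symmetric] add_ac
          flip: one_add_one)
    ultimately show ?thesis
      by (simp add: prod_I card_positions)
  qed
  finally show ?thesis .
qed

definition words :: "nat \<Rightarrow> nat \<Rightarrow> step list set" where
  "words n k = {w. length w = n \<and> count_list w Up = k \<and> count_list w Down = k}"

text \<open>
  A word is determined by the set of its \<open>2 k\<close> slanted positions and the \<open>k\<close> upsteps among them.
\<close>

lemma card_words: "card (words n k) = (n choose (2 * k)) * ((2 * k) choose k)"
proof -
  let ?X = "SIGMA P:k_subsets {..<n} (2 * k). k_subsets P k"
  let ?e = "\<lambda>w. (positions w Up \<union> positions w Down, positions w Up)"
  define d where "d = (\<lambda>(P, Q).
    map (\<lambda>i. if i \<in> Q then Up else if i \<in> P then Down else Flat) [0..<n])"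
  have pos: "positions (d (P, Q)) Up = Q" "positions (d (P, Q)) Down = P - Q"
    if "P \<subseteq> {..<n}" "Q \<subseteq> P" for P Q
    using that by (auto simp: positions_def d_def split: if_splits)
  have "bij_betw ?e (words n k) ?X"
  proof (rule bij_betw_byWitness[where f' = d])
    show "\<forall>w\<in>words n k. d (?e w) = w"
    proof
      fix w assume w: "w \<in> words n k"
      show "d (?e w) = w"
      proof (rule nth_equalityI)
        fix i assume "i < length (d (?e w))"
        then show "d (?e w) ! i = w ! i"
          using w by (cases "w ! i") (auto simp: d_def words_def positions_def)
      qed (use w in \<open>simp add: d_def words_def\<close>)
    qed
    show "\<forall>X\<in>?X. ?e (d X) = X"
      by (auto simp: k_subsets_def pos)
    show "?e ` words n k \<subseteq> ?X"
    proof (rule image_subsetI)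
      fix w assume w: "w \<in> words n k"
      have "card (positions w Up \<union> positions w Down) = 2 * k"
        using w by (subst card_Un_disjoint) (auto simp: positions_disjoint card_positions words_def)
      then show "?e w \<in> ?X"
        using w by (auto simp: k_subsets_def card_positions words_def) (auto simp: positions_def)
    qed
    show "d ` ?X \<subseteq> words n k"
    proof (rule image_subsetI)
      fix X assume X: "X \<in> ?X"
      obtain P Q where PQ: "X = (P, Q)" by (cases X)
      have sub: "P \<subseteq> {..<n}" "card P = 2 * k" "Q \<subseteq> P" "card Q = k"
        using X PQ by (auto simp: k_subsets_def)
      then have "card (P - Q) = k"
        using finite_subset[of P "{..<n}"] finite_subset[of Q P] by (simp add: card_Diff_subset)
      then show "d X \<in> words n k"
        unfolding PQ using sub
        by (simp add: words_def pos card_positions[symmetric]) (simp add: d_def)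
    qed
  qed
  then have "card (words n k) = card ?X"
    by (rule bij_betw_same_card)
  also have "\<dots> = (\<Sum>P\<in>k_subsets {..<n} (2 * k). (2 * k) choose k)"
  proof (subst card_SigmaI)
    have "finite P \<and> card P = 2 * k" if "P \<in> k_subsets {..<n} (2 * k)" for P
      using that by (auto simp: k_subsets_def intro: finite_subset)
    then show "\<forall>P\<in>k_subsets {..<n} (2 * k). finite (k_subsets P k)"
      "(\<Sum>P\<in>k_subsets {..<n} (2 * k). card (k_subsets P k)) =
        (\<Sum>P\<in>k_subsets {..<n} (2 * k). (2 * k) choose k)"
      by (auto simp: finite_k_subsets card_k_subsets intro!: sum.cong)
  qed (simp add: finite_k_subsets)
  finally show ?thesis
    by (simp add: card_k_subsets)
qed

lemma finite_hanna_paths: "finite (hanna_paths n)"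
proof -
  have "l \<le> 5" if "l \<in> step_labels s" for s l
    using that by (cases s) auto
  then have "hanna_paths n \<subseteq> {p. set p \<subseteq> UNIV \<times> {..5} \<and> length p = n}"
    unfolding hanna_paths_def by fastforce
  then show ?thesis
    by (rule finite_subset) (auto intro: finite_lists_length_eq simp: UNIV_step)
qed

lemma sum_hanna_paths_upsteps:
  fixes Y :: "'a :: comm_semiring_1"
  shows "(\<Sum>p | p \<in> hanna_paths n \<and> num_upsteps p = k. Y ^ weight p) =
    of_nat ((n choose (2 * k)) * ((2 * k) choose k)) * (1 + 3 * Y) ^ k * (2 + 3 * Y) ^ (n - 2 * k)"
proof -
  let ?S = "{p. p \<in> hanna_paths n \<and> num_upsteps p = k}"
  have "words n k \<subseteq> {w. set w \<subseteq> UNIV \<and> length w = n}" by (auto simp: words_def)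
  then have fin: "finite (words n k)"
    by (rule finite_subset) (auto intro: finite_lists_length_eq simp: UNIV_step)
  have "(\<Sum>p\<in>?S. Y ^ weight p) = (\<Sum>w\<in>words n k. \<Sum>p | p \<in> ?S \<and> map fst p = w. Y ^ weight p)"
    by (intro sum.group[symmetric] fin finite_subset[OF _ finite_hanna_paths[of n]])
       (auto simp: hanna_paths_def words_def num_upsteps_def delannoy_path_def)
  also have "\<dots> = (\<Sum>w\<in>words n k. (1 + 3 * Y) ^ k * (2 + 3 * Y) ^ (n - 2 * k))"
  proof (rule sum.cong)
    fix w assume w: "w \<in> words n k"
    then have "{p. p \<in> ?S \<and> map fst p = w} = labelings w"
      by (auto simp: hanna_paths_def words_def num_upsteps_def delannoy_path_def labelings_def)
    moreover have "delannoy_path w" "count_list w Up = k" "count_list w Flat = n - 2 * k"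
      using w count_steps[of w] by (auto simp: words_def delannoy_path_def)
    ultimately show "(\<Sum>p | p \<in> ?S \<and> map fst p = w. Y ^ weight p) =
        (1 + 3 * Y) ^ k * (2 + 3 * Y) ^ (n - 2 * k)"
      by (simp add: sum_labelings)
  qed simp
  finally show ?thesis
    by (simp add: card_words mult_ac)
qed

lemma card_hanna_paths_by_upsteps:
  "card {p \<in> hanna_paths n. num_upsteps p = k} =
    (n choose (2 * k)) * ((2 * k) choose k) * 4 ^ k * 5 ^ (n - 2 * k)"
  using sum_hanna_paths_upsteps[where Y = "1 :: nat" and n = n and k = k] by simp

lemma sum_hanna_paths:
  fixes Y :: "'a :: comm_semiring_1"
  shows "(\<Sum>p\<in>hanna_paths n. Y ^ weight p) =
    (\<Sum>m\<le>n. of_nat ((n choose m) * ((2 * n - m) choose n) * 3 ^ m) * Y ^ m)"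
proof -
  have "2 * num_upsteps p \<le> n" if "p \<in> hanna_paths n" for p
    using that count_steps[of "map fst p"]
    by (auto simp: hanna_paths_def num_upsteps_def delannoy_path_def)
  moreover have "finite {k. 2 * k \<le> n}"
    by (rule finite_subset[of _ "{..n}"]) auto
  ultimately have "(\<Sum>p\<in>hanna_paths n. Y ^ weight p) =
      (\<Sum>k | 2 * k \<le> n. \<Sum>p | p \<in> hanna_paths n \<and> num_upsteps p = k. Y ^ weight p)"
    by (intro sum.group[symmetric] finite_hanna_paths) auto
  then show ?thesis
    by (simp only: sum_hanna_paths_upsteps sum_trinomial_eq_sum_shifted)
qed

text \<open>
  The generating polynomial of the weight, read off at an indeterminate \<open>Y\<close>.
\<close>

lemma card_hanna_paths_by_weight:
  assumes "k \<le> n"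
  shows "card {p \<in> hanna_paths n. weight p = k} = (n choose k) * ((2 * n - k) choose n) * 3 ^ k"
proof -
  let ?Y = "monom (1 :: nat) 1"
  have "card {p \<in> hanna_paths n. weight p = k} = coeff (\<Sum>p\<in>hanna_paths n. ?Y ^ weight p) k"
    using finite_hanna_paths[of n] by (simp add: coeff_sum monom_power sum.If_cases Int_def)
  also have "\<dots> = coeff (\<Sum>m\<le>n. of_nat ((n choose m) * ((2 * n - m) choose n) * 3 ^ m) * ?Y ^ m) k"
    by (simp only: sum_hanna_paths)
  also have "\<dots> = (\<Sum>m\<le>n. if m = k then (n choose m) * ((2 * n - m) choose n) * 3 ^ m else 0)"
    unfolding coeff_sum of_nat_mult_conv_smult
    by (intro sum.cong refl) (simp add: monom_power)
  also have "\<dots> = (n choose k) * ((2 * n - k) choose n) * 3 ^ k"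
    using assms by simp
  finally show ?thesis .
qed

section \<open>The four interpretations\<close>

theorem mainTheorem7:
  fixes n :: nat
  shows
    "(\<Sum>k=0..n. (n choose k) * ((2 * k) choose k) * 2 ^ k)
       = (\<Sum>k=0..n. (n choose k) * ((2 * n - k) choose n) * 3 ^ k) \<and>
     (\<Sum>k=0..n. (n choose k) * ((2 * n - k) choose n) * 3 ^ k)
       = (\<Sum>k=0..n. (n choose k) ^ 2 * 4 ^ k) \<and>
     (\<Sum>k=0..n. (n choose k) ^ 2 * 4 ^ k)
       = (\<Sum>k | 2 * k \<le> n. (n choose (2 * k)) * ((2 * k) choose k) * 4 ^ k * 5 ^ (n - 2 * k)) \<and>
     (\<forall>k \<le> n. card {h \<in> hanna_deals n. card (h Red) = k}
       = (n choose k) * ((2 * k) choose k) * 2 ^ k) \<and>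
     (\<forall>k \<le> n. card {p \<in> hanna_paths n. pairs_not_both_1 p + flats_above_2 p = k}
       = (n choose k) * ((2 * n - k) choose n) * 3 ^ k) \<and>
     (\<forall>k \<le> n. card {A \<in> hanna_matrices n. \<forall>i < 2. ones_in_row A i = n - k}
       = (n choose k) ^ 2 * 4 ^ k) \<and>
     (\<forall>k \<le> n. card {h \<in> hanna_deals n. card (snd ` h Red) = k}
       = (n choose k) ^ 2 * 4 ^ k) \<and>
     (\<forall>k. 2 * k \<le> n \<longrightarrow> card {p \<in> hanna_paths n. num_upsteps p = k}
       = (n choose (2 * k)) * ((2 * k) choose k) * 4 ^ k * 5 ^ (n - 2 * k))"
proof (intro conjI allI impI)
  show "(\<Sum>k=0..n. (n choose k) * ((2 * k) choose k) * 2 ^ k)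
      = (\<Sum>k=0..n. (n choose k) * ((2 * n - k) choose n) * 3 ^ k)"
    by (simp only: sum_by_size_eq_sum_by_denominations sum_squares_eq_sum_trinomial
        sum_shifted_eq_sum_trinomial)
  show "(\<Sum>k=0..n. (n choose k) * ((2 * n - k) choose n) * 3 ^ k)
      = (\<Sum>k=0..n. (n choose k) ^ 2 * 4 ^ k)"
    by (simp only: sum_squares_eq_sum_trinomial sum_shifted_eq_sum_trinomial)
qed (simp_all only: sum_squares_eq_sum_trinomial card_hanna_deals_by_size card_hanna_paths_by_weight
    card_hanna_matrices card_hanna_deals_by_denominations card_hanna_paths_by_upsteps)

end
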